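(* Let $K=\{z\in\mathbb{C}: |z|\le 1\}$ be the closed unit disc. There is no entire function $\Phi\colon\mathbb{C}\to\mathbb{C}$ with the following property: for every orthogonally additive polynomial $P\colon C(K)\to\mathbb{C}$ of degree two there is a regular (complex) Borel measure $\mu$ on $K$ such that $$P(x)=\int_K \Phi\circ x\, d\mu\quad\text{for all } x\in C(K).$$
   Context: $C(K)$ is the Banach algebra of complex-valued continuous functions on the compact Hausdorff space $K$ with the supremum norm. A polynomial of degree two on $C(K)$ is a (not necessarily homogeneous) continuous polynomial $P=P_0+P_1+P_2$ with $P_k$ a continuous $k$-homogeneous polynomial and $P_2\neq 0$. A function $f\colon C(K)\to\mathbb{C}$ is orthogonally additive if $f(x+y)=f(x)+f(y)$ whenever $x,y\in C(K)$ satisfy $xy=0$ on $K$. *)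

theory Defs
  imports "HOL-Complex_Analysis.Complex_Analysis"
begin

subsection \<open>The space $C(K)$\<close>

text \<open>
  The points of the library metric space \<^const>\<open>cfunspace\<close> are the bounded continuous functions on
  \<open>K\<close>, canonically set to \<^const>\<open>undefined\<close> outside \<open>K\<close>, and its distance is the supremum distance.
  For compact \<open>K\<close> boundedness is automatic.
\<close>

definition CK :: "'a::topological_space set \<Rightarrow> ('a \<Rightarrow> complex) metric"
  where "CK K = cfunspace (top_of_set K) euclidean_metric"

definition fun_add :: "'a set \<Rightarrow> ('a \<Rightarrow> complex) \<Rightarrow> ('a \<Rightarrow> complex) \<Rightarrow> ('a \<Rightarrow> complex)"
  where "fun_add K x y = (\<lambda>t\<in>K. x t + y t)"

definition fun_scale :: "'a set \<Rightarrow> complex \<Rightarrow> ('a \<Rightarrow> complex) \<Rightarrow> ('a \<Rightarrow> complex)"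
  where "fun_scale K c x = (\<lambda>t\<in>K. c * x t)"

subsection \<open>Polynomials on $C(K)$\<close>

text \<open>
  A \<open>k\<close>-linear form takes its \<open>k\<close> arguments as a list of length \<open>k\<close>; its values on other lists are
  irrelevant. For \<open>k = 0\<close> the homogeneous polynomials are the constants.
\<close>

definition multilinear_form ::
    "'a::topological_space set \<Rightarrow> nat \<Rightarrow> (('a \<Rightarrow> complex) list \<Rightarrow> complex) \<Rightarrow> bool"
  where "multilinear_form K k A \<longleftrightarrow>
    (\<forall>xs i x y c. length xs = k \<and> set xs \<subseteq> mspace (CK K) \<and> i < k
        \<and> x \<in> mspace (CK K) \<and> y \<in> mspace (CK K) \<longrightarrow>
      A (xs[i := fun_add K x y]) = A (xs[i := x]) + A (xs[i := y]) \<and>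
      A (xs[i := fun_scale K c x]) = c * A (xs[i := x]))"

definition homogeneous_polynomial ::
    "'a::topological_space set \<Rightarrow> nat \<Rightarrow> (('a \<Rightarrow> complex) \<Rightarrow> complex) \<Rightarrow> bool"
  where "homogeneous_polynomial K k P \<longleftrightarrow>
    (\<exists>A. multilinear_form K k A \<and> (\<forall>x\<in>mspace (CK K). P x = A (replicate k x)))"

definition continuous_homogeneous_polynomial ::
    "'a::topological_space set \<Rightarrow> nat \<Rightarrow> (('a \<Rightarrow> complex) \<Rightarrow> complex) \<Rightarrow> bool"
  where "continuous_homogeneous_polynomial K k P \<longleftrightarrow>
    homogeneous_polynomial K k P \<and> continuous_map (mtopology_of (CK K)) euclidean P"

definition polynomial_of_degree ::
    "'a::topological_space set \<Rightarrow> nat \<Rightarrow> (('a \<Rightarrow> complex) \<Rightarrow> complex) \<Rightarrow> bool"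
  where "polynomial_of_degree K n P \<longleftrightarrow>
    (\<exists>Q. (\<forall>k\<le>n. continuous_homogeneous_polynomial K k (Q k))
       \<and> (\<exists>x\<in>mspace (CK K). Q n x \<noteq> 0)
       \<and> (\<forall>x\<in>mspace (CK K). P x = (\<Sum>k\<le>n. Q k x)))"

definition orthogonally_additive ::
    "'a::topological_space set \<Rightarrow> (('a \<Rightarrow> complex) \<Rightarrow> complex) \<Rightarrow> bool"
  where "orthogonally_additive K f \<longleftrightarrow>
    (\<forall>x\<in>mspace (CK K). \<forall>y\<in>mspace (CK K).
      (\<forall>t\<in>K. x t * y t = 0) \<longrightarrow> f (fun_add K x y) = f x + f y)"

subsection \<open>Complex measures\<close>

text \<open>
  A measure \<open>M\<close> is used below only for its underlying measurable space. Countable additivity as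
  stated includes the value \<open>0\<close> on the empty set (take all \<open>A n\<close> empty).
\<close>

definition complex_measure :: "'a measure \<Rightarrow> ('a set \<Rightarrow> complex) \<Rightarrow> bool"
  where "complex_measure M \<mu> \<longleftrightarrow>
    (\<forall>A :: nat \<Rightarrow> 'a set. range A \<subseteq> sets M \<and> disjoint_family A \<longrightarrow>
      (\<lambda>n. \<mu> (A n)) sums \<mu> (\<Union>n. A n))"

definition total_variation :: "'a measure \<Rightarrow> ('a set \<Rightarrow> complex) \<Rightarrow> 'a set \<Rightarrow> ennreal"
  where "total_variation M \<mu> E =
    (SUP A \<in> {A :: nat \<Rightarrow> 'a set. range A \<subseteq> sets M \<and> disjoint_family A \<and> (\<Union>n. A n) = E}.
      \<Sum>n. ennreal (cmod (\<mu> (A n))))"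

definition regular_complex_borel_measure ::
    "'a::topological_space set \<Rightarrow> ('a set \<Rightarrow> complex) \<Rightarrow> bool"
  where "regular_complex_borel_measure K \<mu> \<longleftrightarrow>
    (let M = restrict_space borel K; v = total_variation M \<mu> in
      complex_measure M \<mu> \<and>
      (\<forall>E\<in>sets M.
        v E = (INF U \<in> {U. openin (top_of_set K) U \<and> E \<subseteq> U}. v U) \<and>
        v E = (SUP C \<in> {C. compact C \<and> C \<subseteq> E}. v C)))"

text \<open>
  Integration goes through the Jordan decomposition. For a signed measure \<open>\<nu>\<close>, the positive part
  has value $\sup\{\nu(F) : F \subseteq E\}$ at \<open>E\<close>, and the negative part is the positive part of
  \<open>-\<nu>\<close>. (\<^const>\<open>ennreal\<close> sends negative reals to \<open>0\<close>, which does not change the supremum, as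
  $\nu(\emptyset) = 0$ takes part in it.)
\<close>

definition positive_part :: "'a measure \<Rightarrow> ('a set \<Rightarrow> real) \<Rightarrow> 'a measure"
  where "positive_part M \<nu> =
    measure_of (space M) (sets M) (\<lambda>E. SUP F \<in> {F \<in> sets M. F \<subseteq> E}. ennreal (\<nu> F))"

definition signed_integral :: "'a measure \<Rightarrow> ('a set \<Rightarrow> real) \<Rightarrow> ('a \<Rightarrow> complex) \<Rightarrow> complex"
  where "signed_integral M \<nu> f =
    (\<integral>t. f t \<partial>positive_part M \<nu>) - (\<integral>t. f t \<partial>positive_part M (\<lambda>E. - \<nu> E))"

definition complex_integral :: "'a measure \<Rightarrow> ('a set \<Rightarrow> complex) \<Rightarrow> ('a \<Rightarrow> complex) \<Rightarrow> complex"
  where "complex_integral M \<mu> f =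
    signed_integral M (\<lambda>E. Re (\<mu> E)) f + \<i> * signed_integral M (\<lambda>E. Im (\<mu> E)) f"

end

theory Submission
  imports Defs
begin

text \<open>
  The polynomial $P(x) = x(0) + x(1)^2$ defeats every candidate \<open>\<Phi>\<close>: a single measure would have to
  be concentrated at \<open>0\<close> because of the linear part of \<open>P\<close> and at \<open>1\<close> because of its quadratic part.

  Write \<open>I\<close> for the integral against a measure representing \<open>P\<close>. It is linear and bounded by a
  multiple of the supremum norm (\<open>complex_integral_add\<close>, \<open>complex_integral_mult\<close>,
  \<open>complex_integral_bound\<close>), since a complex measure is bounded (\<open>complex_measure_bounded\<close>).
  Let $a_1, a_2$ be the Taylor coefficients of \<open>\<Phi>\<close> at \<open>0\<close>. For small real \<open>s\<close>, the number
  $I(\Phi \circ sx)$ is both $s\,x(0) + s^2 x(1)^2$ and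
  $a_0 I(1) + s\,a_1 I(x) + s^2 a_2 I(x^2) + O(s^3)$, and comparison of coefficients gives
  $a_1 I(x) = x(0)$ and $a_2 I(x^2) = x(1)^2$ (\<open>complex_integral_Taylor_coefficients\<close>).
  The first identity at $x = 1$ shows $a_1 \neq 0$, and at $x = t^2$ then shows $I(t^2) = 0$. The
  second identity at $x = t$ says $a_2 I(t^2) = 1$, a contradiction.
\<close>

section \<open>Finiteness of complex measures\<close>

lemma complex_measure_empty:
  assumes "complex_measure M \<mu>"
  shows "\<mu> {} = 0"
proof -
  have "(\<lambda>n::nat. \<mu> {}) sums \<mu> {}"
    using assms unfolding complex_measure_def
    by (drule_tac spec[of _ "\<lambda>n. {}"]) (auto simp: disjoint_family_on_def)
  then show ?thesis
    using sums_summable summable_const_iff by blast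
qed

lemma complex_measure_Un:
  assumes "complex_measure M \<mu>" "A \<in> sets M" "B \<in> sets M" "A \<inter> B = {}"
  shows "\<mu> (A \<union> B) = \<mu> A + \<mu> B"
proof -
  have "disjoint_family (binaryset A B)"
    using assms(4) by (auto simp: disjoint_family_on_def binaryset_def)
  moreover have "range (binaryset A B) \<subseteq> sets M"
    using assms(2,3) by (auto simp: range_binaryset_eq)
  ultimately have "(\<lambda>n. \<mu> (binaryset A B n)) sums \<mu> (A \<union> B)"
    using assms(1) unfolding complex_measure_def by (metis UN_binaryset_eq)
  moreover have "(\<lambda>n. \<mu> (binaryset A B n)) sums (\<mu> A + \<mu> B)"
    by (rule binaryset_sums) (rule complex_measure_empty[OF assms(1)])
  ultimately show ?thesis
    using sums_unique2 by blast
qed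

text \<open>
  Otherwise some set contains measurable subsets of arbitrarily large measure, and any such set \<open>A\<close>
  can be shrunk to a subset \<open>A'\<close> of the same kind while removing a piece of measure larger than \<open>1\<close>
  in modulus. Iteration removes infinitely many disjoint pieces whose measures do not tend to \<open>0\<close>,
  against countable additivity.
\<close>

lemma complex_measure_bounded:
  assumes \<mu>: "complex_measure M \<mu>"
  obtains C where "\<And>F. F \<in> sets M \<Longrightarrow> cmod (\<mu> F) \<le> C"
proof -
  define unbdd where
    "unbdd A \<longleftrightarrow> A \<in> sets M \<and> (\<forall>C. \<exists>F\<in>sets M. F \<subseteq> A \<and> cmod (\<mu> F) > C)" for A
  have split: "\<exists>A'. unbdd A' \<and> A' \<subseteq> A \<and> cmod (\<mu> (A - A')) > 1" if unbdd_A: "unbdd A" for A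
  proof -
    have A: "A \<in> sets M"
      using that by (simp add: unbdd_def)
    \<comment> \<open>The margin \<open>cmod (\<mu> A)\<close> makes both \<open>F\<close> and its complement in \<open>A\<close> heavy, so whichever of
      them keeps the unboundedness, the other one can be removed.\<close>
    obtain F where F: "F \<in> sets M" "F \<subseteq> A" "cmod (\<mu> F) > 1 + cmod (\<mu> A)"
      using unbdd_A unfolding unbdd_def by blast
    have "\<mu> F = \<mu> A - \<mu> (A - F)"
      using complex_measure_Un[OF \<mu> F(1), of "A - F"] A F by (simp add: Un_absorb1)
    then have "cmod (\<mu> F) \<le> cmod (\<mu> A) + cmod (\<mu> (A - F))"
      by (simp add: norm_triangle_ineq4)
    then have big: "cmod (\<mu> (A - F)) > 1" "cmod (\<mu> F) > 1"
      using F(3) norm_ge_zero[of "\<mu> A"]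
      by linarith+
    have "unbdd F \<or> unbdd (A - F)"
    proof (rule ccontr)
      assume "\<not> (unbdd F \<or> unbdd (A - F))"
      then obtain C D where
        C: "\<And>G. G \<in> sets M \<Longrightarrow> G \<subseteq> F \<Longrightarrow> cmod (\<mu> G) \<le> C" and
        D: "\<And>G. G \<in> sets M \<Longrightarrow> G \<subseteq> A - F \<Longrightarrow> cmod (\<mu> G) \<le> D"
        unfolding unbdd_def using A F(1) by (meson not_le sets.Diff)
      obtain G where G: "G \<in> sets M" "G \<subseteq> A" "cmod (\<mu> G) > C + D"
        using unbdd_A unfolding unbdd_def by blast
      have "\<mu> G = \<mu> (G \<inter> F) + \<mu> (G - F)"
        using complex_measure_Un[OF \<mu>, of "G \<inter> F" "G - F"] G F
        by (simp add: Int_Diff_Un Int_Diff_disjoint)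
      then have "cmod (\<mu> G) \<le> cmod (\<mu> (G \<inter> F)) + cmod (\<mu> (G - F))"
        by (simp add: norm_triangle_ineq)
      also have "\<dots> \<le> C + D"
        using G F by (intro add_mono C D) auto
      finally show False
        using G(3) by simp
    qed
    moreover have "A - (A - F) = F"
      using F(2) by blast
    ultimately show ?thesis
      using big F(2) by (metis Diff_subset)
  qed
  have "\<not> unbdd (space M)"
  proof
    assume "unbdd (space M)"
    then obtain S where S: "\<And>n::nat. unbdd (S n)"
        "\<And>n. S (Suc n) \<subseteq> S n" "\<And>n. cmod (\<mu> (S n - S (Suc n))) > 1"
      using dependent_nat_choice[of "\<lambda>_. unbdd" "\<lambda>_ A A'. A' \<subseteq> A \<and> cmod (\<mu> (A - A')) > 1"] split
      by metis
    have dec: "S n \<subseteq> S m" if "m \<le> n" for m n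
      using lift_Suc_antimono_le[of S] S(2) that by blast
    have "disjoint_family (\<lambda>n. S n - S (Suc n))"
      unfolding disjoint_family_on_def
    proof (intro ballI impI)
      fix m n :: nat
      assume "m \<noteq> n"
      then consider "Suc m \<le> n" | "Suc n \<le> m"
        by linarith
      then show "(S m - S (Suc m)) \<inter> (S n - S (Suc n)) = {}"
        by cases (use dec in blast)+
    qed
    moreover have "range (\<lambda>n. S n - S (Suc n)) \<subseteq> sets M"
      using S(1) by (auto simp: unbdd_def)
    ultimately have "summable (\<lambda>n. \<mu> (S n - S (Suc n)))"
      using \<mu> unfolding complex_measure_def by (meson sums_summable)
    then have "(\<lambda>n. \<mu> (S n - S (Suc n))) \<longlonglongrightarrow> 0"
      by (rule summable_LIMSEQ_zero)
    from LIMSEQ_D[OF this, of 1] obtain n where "cmod (\<mu> (S n - S (Suc n))) < 1"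
      by auto
    then show False
      using S(3)[of n] by simp
  qed
  then have "\<exists>C. \<forall>F\<in>sets M. F \<subseteq> space M \<longrightarrow> cmod (\<mu> F) \<le> C"
    by (simp add: unbdd_def not_less)
  then obtain C where "\<forall>F\<in>sets M. F \<subseteq> space M \<longrightarrow> cmod (\<mu> F) \<le> C" ..
  then show ?thesis
    by (intro that[of C]) (simp add: sets.sets_into_space)
qed

section \<open>The integral as a bounded linear functional\<close>

lemma space_positive_part [simp]: "space (positive_part M \<nu>) = space M"
  by (simp add: positive_part_def space_measure_of_conv)

lemma sets_positive_part [simp, measurable_cong]: "sets (positive_part M \<nu>) = sets M"
  by (simp add: positive_part_def sets_measure_of_conv sets.space_closed sets.sigma_sets_eq)

text \<open>
  An upper bound on \<open>\<nu>\<close> settles both readings of \<^const>\<open>measure_of\<close>: the total mass is the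
  supremum if that set function is countably additive, and \<open>0\<close> otherwise.
\<close>

lemma finite_measure_positive_part:
  assumes "\<And>F. F \<in> sets M \<Longrightarrow> \<nu> F \<le> C"
  shows "finite_measure (positive_part M \<nu>)"
proof
  have "(SUP F \<in> {F \<in> sets M. F \<subseteq> space M}. ennreal (\<nu> F)) \<le> ennreal C"
    using assms by (intro SUP_least) (auto intro: ennreal_leI)
  then have "emeasure (positive_part M \<nu>) (space M) \<le> ennreal C"
    by (simp add: positive_part_def emeasure_measure_of_conv)
  then show "emeasure (positive_part M \<nu>) (space (positive_part M \<nu>)) \<noteq> \<infinity>"
    by (auto simp: top_unique)
qed

lemma integral_bounded_linear:
  fixes f g :: "'a \<Rightarrow> complex"
  assumes N: "finite_measure N"
    and f: "f \<in> borel_measurable N" "\<And>t. t \<in> space N \<Longrightarrow> cmod (f t) \<le> B"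
  shows integral_add_bounded: "g \<in> borel_measurable N \<Longrightarrow> (\<And>t. t \<in> space N \<Longrightarrow> cmod (g t) \<le> D) \<Longrightarrow>
      (\<integral>t. f t + g t \<partial>N) = (\<integral>t. f t \<partial>N) + (\<integral>t. g t \<partial>N)"
    and norm_integral_le_bound: "cmod (\<integral>t. f t \<partial>N) \<le> measure N (space N) * B"
proof -
  interpret finite_measure N by fact
  have int: "integrable N h" if "h \<in> borel_measurable N" "\<And>t. t \<in> space N \<Longrightarrow> cmod (h t) \<le> D"
    for h :: "'a \<Rightarrow> complex" and D
    using that by (intro integrable_const_bound[of _ D]) auto
  show "(\<integral>t. f t + g t \<partial>N) = (\<integral>t. f t \<partial>N) + (\<integral>t. g t \<partial>N)"
    if "g \<in> borel_measurable N" "\<And>t. t \<in> space N \<Longrightarrow> cmod (g t) \<le> D"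
    using int f that by (intro Bochner_Integration.integral_add) blast+
  have "cmod (\<integral>t. f t \<partial>N) \<le> (\<integral>t. cmod (f t) \<partial>N)"
    by (rule integral_norm_bound)
  also have "\<dots> \<le> (\<integral>t. B \<partial>N)"
    using f by (intro integral_mono integrable_norm int) auto
  finally show "cmod (\<integral>t. f t \<partial>N) \<le> measure N (space N) * B"
    by simp
qed

lemma complex_integral_cong:
  assumes "\<And>t. t \<in> space M \<Longrightarrow> f t = g t"
  shows "complex_integral M \<mu> f = complex_integral M \<mu> g"
proof -
  have "(\<integral>t. f t \<partial>positive_part M \<nu>) = (\<integral>t. g t \<partial>positive_part M \<nu>)" for \<nu>
    using assms by (intro Bochner_Integration.integral_cong) auto
  then show ?thesis
    by (simp add: complex_integral_def signed_integral_def)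
qed

lemma complex_integral_mult:
  "complex_integral M \<mu> (\<lambda>t. c * f t) = c * complex_integral M \<mu> f"
  by (simp add: complex_integral_def signed_integral_def algebra_simps)

lemma finite_Jordan_parts:
  assumes "complex_measure M \<mu>"
  shows "finite_measure (positive_part M (\<lambda>E. Re (\<mu> E)))"
    and "finite_measure (positive_part M (\<lambda>E. - Re (\<mu> E)))"
    and "finite_measure (positive_part M (\<lambda>E. Im (\<mu> E)))"
    and "finite_measure (positive_part M (\<lambda>E. - Im (\<mu> E)))"
proof -
  obtain C where "cmod (\<mu> F) \<le> C" if "F \<in> sets M" for F
    using complex_measure_bounded[OF assms] by blast
  then have "\<bar>Re (\<mu> F)\<bar> \<le> C" "\<bar>Im (\<mu> F)\<bar> \<le> C" if "F \<in> sets M" for F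
    using that abs_Re_le_cmod abs_Im_le_cmod order_trans by blast+
  then show "finite_measure (positive_part M (\<lambda>E. Re (\<mu> E)))"
    and "finite_measure (positive_part M (\<lambda>E. - Re (\<mu> E)))"
    and "finite_measure (positive_part M (\<lambda>E. Im (\<mu> E)))"
    and "finite_measure (positive_part M (\<lambda>E. - Im (\<mu> E)))"
    by (auto intro!: finite_measure_positive_part[of _ _ C] simp: abs_le_iff)
qed

text \<open>
  The Bochner integral of a non-integrable function is \<open>0\<close>, so additivity rests on the finiteness of
  the four Jordan parts, which makes bounded measurable functions integrable.
\<close>

lemma complex_integral_add:
  assumes \<mu>: "complex_measure M \<mu>"
    and f: "f \<in> borel_measurable M" "\<And>t. t \<in> space M \<Longrightarrow> cmod (f t) \<le> B"
    and g: "g \<in> borel_measurable M" "\<And>t. t \<in> space M \<Longrightarrow> cmod (g t) \<le> D"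
  shows "complex_integral M \<mu> (\<lambda>t. f t + g t) = complex_integral M \<mu> f + complex_integral M \<mu> g"
proof -
  have "(\<integral>t. f t + g t \<partial>positive_part M \<nu>)
      = (\<integral>t. f t \<partial>positive_part M \<nu>) + (\<integral>t. g t \<partial>positive_part M \<nu>)"
    if "finite_measure (positive_part M \<nu>)" for \<nu>
    using f g by (intro integral_add_bounded[OF that, of f B g D])
      (auto simp: measurable_cong_sets[OF sets_positive_part refl])
  then show ?thesis
    using finite_Jordan_parts[OF \<mu>]
    by (simp add: complex_integral_def signed_integral_def algebra_simps)
qed

lemma complex_integral_bound:
  assumes \<mu>: "complex_measure M \<mu>"
  obtains C where "C \<ge> 0"
    and "\<And>f B. f \<in> borel_measurable M \<Longrightarrow> (\<And>t. t \<in> space M \<Longrightarrow> cmod (f t) \<le> B) \<Longrightarrow>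
      cmod (complex_integral M \<mu> f) \<le> C * B"
proof -
  define m where "m \<nu> = measure (positive_part M \<nu>) (space M)" for \<nu>
  define C where "C = m (\<lambda>E. Re (\<mu> E)) + m (\<lambda>E. - Re (\<mu> E))
    + (m (\<lambda>E. Im (\<mu> E)) + m (\<lambda>E. - Im (\<mu> E)))"
  have "cmod (complex_integral M \<mu> f) \<le> C * B"
    if f: "f \<in> borel_measurable M" "\<And>t. t \<in> space M \<Longrightarrow> cmod (f t) \<le> B" for f B
  proof -
    have part: "cmod (\<integral>t. f t \<partial>positive_part M \<nu>) \<le> m \<nu> * B"
      if "finite_measure (positive_part M \<nu>)" for \<nu>
      using norm_integral_le_bound[OF that, of f B] f
      by (auto simp: measurable_cong_sets[OF sets_positive_part refl] m_def)
    have "cmod (complex_integral M \<mu> f)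
        \<le> cmod (signed_integral M (\<lambda>E. Re (\<mu> E)) f) + cmod (signed_integral M (\<lambda>E. Im (\<mu> E)) f)"
      unfolding complex_integral_def
      by (rule order_trans[OF norm_triangle_ineq]) (simp add: norm_mult)
    also have "\<dots> \<le> (m (\<lambda>E. Re (\<mu> E)) * B + m (\<lambda>E. - Re (\<mu> E)) * B)
        + (m (\<lambda>E. Im (\<mu> E)) * B + m (\<lambda>E. - Im (\<mu> E)) * B)"
      unfolding signed_integral_def
      by (intro add_mono order_trans[OF norm_triangle_ineq4] part finite_Jordan_parts[OF \<mu>])
    finally show ?thesis
      by (simp add: C_def algebra_simps)
  qed
  moreover have "C \<ge> 0"
    by (simp add: C_def m_def)
  ultimately show ?thesis
    by (rule that[rotated])
qed

section \<open>Comparison of Taylor coefficients\<close>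

lemma entire_quadratic_remainder:
  assumes "\<Phi> holomorphic_on UNIV"
  obtains B where "B \<ge> 0"
    and "\<And>w. cmod w \<le> 1 \<Longrightarrow>
      cmod (\<Phi> w - (\<Phi> 0 + deriv \<Phi> 0 * w + deriv (deriv \<Phi>) 0 / 2 * w^2)) \<le> B * cmod w ^ 3"
proof -
  have hol: "(deriv ^^ i) \<Phi> holomorphic_on UNIV" for i
    by (intro holomorphic_higher_deriv assms) auto
  have "compact ((deriv ^^ Suc 2) \<Phi> ` cball 0 1)"
    using hol by (intro compact_continuous_image)
      (auto intro: holomorphic_on_imp_continuous_on holomorphic_on_subset)
  then obtain B where B: "B > 0" "\<And>w. w \<in> cball 0 1 \<Longrightarrow> cmod ((deriv ^^ Suc 2) \<Phi> w) \<le> B"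
    using bounded_pos compact_imp_bounded by (metis imageI)
  have der: "((deriv ^^ i) \<Phi> has_field_derivative (deriv ^^ Suc i) \<Phi> w) (at w within cball 0 1)"
    for i w
    using holomorphic_derivI[OF hol[of i] open_UNIV UNIV_I]
    by (simp add: has_field_derivative_at_within)
  show ?thesis
  proof (rule that[of "B / 2"])
    fix w :: complex
    assume w: "cmod w \<le> 1"
    have "cmod ((deriv ^^ 0) \<Phi> w - (\<Sum>i\<le>2. (deriv ^^ i) \<Phi> 0 * (w - 0) ^ i / fact i))
        \<le> B * cmod (w - 0) ^ Suc 2 / fact 2"
      by (rule complex_Taylor[of "cball 0 1" 2 "\<lambda>i. (deriv ^^ i) \<Phi>"]) (use w der B(2) in auto)
    then show "cmod (\<Phi> w - (\<Phi> 0 + deriv \<Phi> 0 * w + deriv (deriv \<Phi>) 0 / 2 * w^2))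
        \<le> B / 2 * cmod w ^ 3"
      by (simp add: numeral_2_eq_2 numeral_3_eq_3 mult.commute)
  qed (use B in auto)
qed

lemma zero_of_linear_bound:
  fixes f :: "real \<Rightarrow> complex"
  assumes "isCont f 0" "\<And>s. 0 < s \<Longrightarrow> s \<le> 1 \<Longrightarrow> cmod (f s) \<le> B * s"
  shows "f 0 = 0"
proof -
  have "(f \<longlongrightarrow> f 0) (at_right 0)"
    using assms(1) by (simp add: isCont_def filterlim_at_split)
  moreover have "(f \<longlongrightarrow> 0) (at_right 0)"
  proof (rule Lim_null_comparison)
    show "\<forall>\<^sub>F s in at_right 0. cmod (f s) \<le> B * s"
      using assms(2) unfolding eventually_at_right[OF zero_less_one] by (intro exI[of _ 1]) auto
    show "((\<lambda>s. B * s) \<longlongrightarrow> 0) (at_right (0::real))"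
      by (auto intro!: tendsto_eq_intros)
  qed
  ultimately show ?thesis
    using tendsto_unique by (metis trivial_limit_at_right_real)
qed

text \<open>
  The coefficients vanish one after the other: let \<open>s\<close> tend to \<open>0\<close>, divide by \<open>s\<close>, and repeat.
\<close>

lemma quadratic_zero_of_cubic_bound:
  fixes c\<^sub>0 c\<^sub>1 c\<^sub>2 :: complex
  assumes "B \<ge> 0"
    and bound: "\<And>s::real. 0 < s \<Longrightarrow> s \<le> 1 \<Longrightarrow> cmod (c\<^sub>0 + c\<^sub>1 * of_real s + c\<^sub>2 * (of_real s)^2) \<le> B * s^3"
  shows "c\<^sub>1 = 0" "c\<^sub>2 = 0"
proof -
  have "c\<^sub>0 + c\<^sub>1 * of_real 0 + c\<^sub>2 * (of_real 0)^2 = 0"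
  proof (rule zero_of_linear_bound)
    show "cmod (c\<^sub>0 + c\<^sub>1 * of_real s + c\<^sub>2 * (of_real s)^2) \<le> B * s" if "0 < s" "s \<le> 1" for s :: real
    proof -
      have "s ^ 3 \<le> s"
        using that power_decreasing[of 1 3 s] by simp
      then show ?thesis
        using bound[OF that] \<open>B \<ge> 0\<close> by (meson mult_left_mono order_trans)
    qed
  qed (auto intro!: continuous_intros)
  then have c0: "c\<^sub>0 = 0"
    by simp
  have bound1: "cmod (c\<^sub>1 + c\<^sub>2 * of_real s) \<le> B * s^2" if "0 < s" "s \<le> 1" for s :: real
  proof -
    have "c\<^sub>1 * of_real s + c\<^sub>2 * (of_real s)^2 = of_real s * (c\<^sub>1 + c\<^sub>2 * of_real s)"
      by (simp add: algebra_simps power2_eq_square)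
    then have "s * cmod (c\<^sub>1 + c\<^sub>2 * of_real s) \<le> s * (B * s^2)"
      using bound[OF that] that
      by (simp add: c0 norm_mult del: of_real_power) (simp add: power2_eq_square power3_eq_cube mult_ac)
    then show ?thesis
      using that by simp
  qed
  have "c\<^sub>1 + c\<^sub>2 * of_real 0 = 0"
  proof (rule zero_of_linear_bound)
    show "cmod (c\<^sub>1 + c\<^sub>2 * of_real s) \<le> B * s" if "0 < s" "s \<le> 1" for s :: real
    proof -
      have "s ^ 2 \<le> s"
        using that power_decreasing[of 1 2 s] by simp
      then show ?thesis
        using bound1[OF that] \<open>B \<ge> 0\<close> by (meson mult_left_mono order_trans)
    qed
  qed (auto intro!: continuous_intros)
  then show c1: "c\<^sub>1 = 0"
    by simp
  show "c\<^sub>2 = 0"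
  proof (rule zero_of_linear_bound[of "\<lambda>_. c\<^sub>2" B])
    show "cmod c\<^sub>2 \<le> B * s" if "0 < s" "s \<le> 1" for s :: real
      using bound1[OF that] that by (simp add: c1 norm_mult power2_eq_square)
  qed auto
qed

text \<open>
  The remainder of the second-order expansion of \<open>\<Phi> (s * x t)\<close> is at most \<open>B * s^3\<close> uniformly
  in \<open>t\<close>, hence its integral is of order $s^3$ as well. The difference of the two quadratic
  polynomials in \<open>s\<close> is therefore $O(s^3)$.
\<close>

lemma complex_integral_Taylor_coefficients:
  assumes \<mu>: "complex_measure M \<mu>" and \<Phi>: "\<Phi> holomorphic_on UNIV"
    and x: "x \<in> borel_measurable M" "\<And>t. t \<in> space M \<Longrightarrow> cmod (x t) \<le> 1"
    and eq: "\<And>s::real. 0 < s \<Longrightarrow> s \<le> 1 \<Longrightarrow>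
      complex_integral M \<mu> (\<lambda>t. \<Phi> (of_real s * x t)) = b\<^sub>1 * of_real s + b\<^sub>2 * (of_real s)^2"
  shows "deriv \<Phi> 0 * complex_integral M \<mu> x = b\<^sub>1"
    and "deriv (deriv \<Phi>) 0 / 2 * complex_integral M \<mu> (\<lambda>t. (x t)^2) = b\<^sub>2"
proof -
  let ?I = "complex_integral M \<mu>"
  define a\<^sub>0 a\<^sub>1 a\<^sub>2 where a: "a\<^sub>0 = \<Phi> 0" "a\<^sub>1 = deriv \<Phi> 0" "a\<^sub>2 = deriv (deriv \<Phi>) 0 / 2"
  define R where "R w = \<Phi> w - (a\<^sub>0 + a\<^sub>1 * w + a\<^sub>2 * w^2)" for w
  obtain B where B: "B \<ge> 0" "\<And>w. cmod w \<le> 1 \<Longrightarrow> cmod (R w) \<le> B * cmod w ^ 3"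
    using entire_quadratic_remainder[OF \<Phi>] unfolding R_def a by metis
  obtain C where C: "C \<ge> 0" "\<And>f B. f \<in> borel_measurable M \<Longrightarrow>
      (\<And>t. t \<in> space M \<Longrightarrow> cmod (f t) \<le> B) \<Longrightarrow> cmod (?I f) \<le> C * B"
    using complex_integral_bound[OF \<mu>] by metis
  have "continuous_on UNIV R"
    unfolding R_def using holomorphic_on_imp_continuous_on[OF \<Phi>] by (intro continuous_intros) auto
  then have R_meas: "R \<in> borel_measurable borel"
    by (rule borel_measurable_continuous_onI)
  note [measurable] = x(1) R_meas
  have key: "cmod (a\<^sub>0 * ?I (\<lambda>_. 1) + (a\<^sub>1 * ?I x - b\<^sub>1) * of_real s + (a\<^sub>2 * ?I (\<lambda>t. (x t)^2) - b\<^sub>2) * (of_real s)^2)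
      \<le> C * B * s^3" if s: "0 < s" "s \<le> 1" for s :: real
  proof -
    have small: "cmod (of_real s * x t) \<le> s" "cmod (of_real s * x t) \<le> 1" "cmod ((of_real s)^2 * (x t)^2) \<le> 1"
      if "t \<in> space M" for t
    proof -
      show 1: "cmod (of_real s * x t) \<le> s"
        using x(2)[OF that] s by (simp add: norm_mult mult_left_le)
      then show 2: "cmod (of_real s * x t) \<le> 1"
        using s by simp
      show "cmod ((of_real s)^2 * (x t)^2) \<le> 1"
        using power_le_one[OF norm_ge_zero 2, of 2] by (simp add: norm_mult norm_power power_mult_distrib)
    qed
    have R: "cmod (R (of_real s * x t)) \<le> B * s^3" if "t \<in> space M" for t
    proof -
      have "cmod (of_real s * x t) ^ 3 \<le> s ^ 3"
        using small(1)[OF that] by (intro power_mono) auto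
      then show ?thesis
        using B(2)[OF small(2)[OF that]] B(1) by (meson mult_left_mono order_trans)
    qed
    \<comment> \<open>Each product is grouped as a constant times a function bounded by \<open>1\<close>, so that additivity
      and homogeneity of the integral apply term by term.\<close>
    define q where "q t = a\<^sub>1 * (of_real s * x t) + a\<^sub>2 * ((of_real s)^2 * (x t)^2)" for t
    have bounds: "cmod (a\<^sub>1 * (of_real s * x t)) \<le> cmod a\<^sub>1" "cmod (a\<^sub>2 * ((of_real s)^2 * (x t)^2)) \<le> cmod a\<^sub>2"
        "cmod (q t) \<le> cmod a\<^sub>1 + cmod a\<^sub>2" "cmod (a\<^sub>0 * 1 + q t) \<le> cmod a\<^sub>0 + (cmod a\<^sub>1 + cmod a\<^sub>2)"
      if "t \<in> space M" for t
    proof -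
      show 1: "cmod (a\<^sub>1 * (of_real s * x t)) \<le> cmod a\<^sub>1"
        using small(2)[OF that] by (metis mult_left_le norm_ge_zero norm_mult)
      show 2: "cmod (a\<^sub>2 * ((of_real s)^2 * (x t)^2)) \<le> cmod a\<^sub>2"
        using small(3)[OF that] by (metis mult_left_le norm_ge_zero norm_mult)
      show 3: "cmod (q t) \<le> cmod a\<^sub>1 + cmod a\<^sub>2"
        unfolding q_def by (rule norm_triangle_mono[OF 1 2])
      show "cmod (a\<^sub>0 * 1 + q t) \<le> cmod a\<^sub>0 + (cmod a\<^sub>1 + cmod a\<^sub>2)"
        by (rule norm_triangle_mono[OF _ 3]) simp
    qed
    have [measurable]: "q \<in> borel_measurable M"
      unfolding q_def by measurable
    have "?I (\<lambda>t. \<Phi> (of_real s * x t)) = ?I (\<lambda>t. (a\<^sub>0 * 1 + q t) + R (of_real s * x t))"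
      by (intro complex_integral_cong) (simp add: R_def q_def power_mult_distrib)
    also have "\<dots> = ?I (\<lambda>t. a\<^sub>0 * 1 + q t) + ?I (\<lambda>t. R (of_real s * x t))"
      by (rule complex_integral_add[OF \<mu> _ bounds(4) _ R]) measurable
    also have "?I (\<lambda>t. a\<^sub>0 * 1 + q t) = ?I (\<lambda>t. a\<^sub>0 * 1) + ?I q"
      by (rule complex_integral_add[OF \<mu> _ _ _ bounds(3), where B = "cmod a\<^sub>0"]) auto
    also have "?I q = ?I (\<lambda>t. a\<^sub>1 * (of_real s * x t)) + ?I (\<lambda>t. a\<^sub>2 * ((of_real s)^2 * (x t)^2))"
      unfolding q_def by (rule complex_integral_add[OF \<mu> _ bounds(1) _ bounds(2)]) measurable
    finally have "b\<^sub>1 * of_real s + b\<^sub>2 * (of_real s)^2 = a\<^sub>0 * ?I (\<lambda>_. 1) + a\<^sub>1 * (of_real s * ?I x)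
        + a\<^sub>2 * ((of_real s)^2 * ?I (\<lambda>t. (x t)^2)) + ?I (\<lambda>t. R (of_real s * x t))"
      unfolding eq[OF s] complex_integral_mult by (simp add: add.assoc)
    then have "a\<^sub>0 * ?I (\<lambda>_. 1) + (a\<^sub>1 * ?I x - b\<^sub>1) * of_real s + (a\<^sub>2 * ?I (\<lambda>t. (x t)^2) - b\<^sub>2) * (of_real s)^2
        = - ?I (\<lambda>t. R (of_real s * x t))"
      by (simp add: algebra_simps)
    moreover have "cmod (?I (\<lambda>t. R (of_real s * x t))) \<le> C * (B * s^3)"
      by (rule C(2)[OF _ R]) measurable
    ultimately show ?thesis
      by (simp add: mult.assoc)
  qed
  have "C * B \<ge> 0"
    using B C by simp
  from quadratic_zero_of_cubic_bound[OF this key]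
  show "deriv \<Phi> 0 * ?I x = b\<^sub>1" "deriv (deriv \<Phi>) 0 / 2 * ?I (\<lambda>t. (x t)^2) = b\<^sub>2"
    by (simp_all add: a)
qed

section \<open>A polynomial mixing two point evaluations\<close>

lemma mspace_CK:
  assumes "compact K"
  shows "x \<in> mspace (CK K) \<longleftrightarrow> continuous_on K x \<and> x \<in> extensional K"
proof -
  have "bounded (x ` K)" if "continuous_on K x"
    by (rule compact_imp_bounded[OF compact_continuous_image[OF that assms]])
  then show ?thesis
    by (auto simp: CK_def)
qed

text \<open>Evaluation at a point is \<open>1\<close>-Lipschitz for the supremum distance.\<close>

lemma continuous_map_evaluation:
  fixes K :: "'a::topological_space set"
  assumes "p \<in> K"
  shows "continuous_map (mtopology_of (CK K)) euclidean (\<lambda>x. x p)"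
proof -
  have "dist (x p) (y p) \<le> mdist (CK K) x y" if "x \<in> mspace (CK K)" "y \<in> mspace (CK K)" for x y
  proof -
    have "x \<in> mspace (funspace K euclidean_metric)" "y \<in> mspace (funspace K euclidean_metric)"
      using that by (auto simp: CK_def cfunspace_def)
    then show ?thesis
      using funspace_mdist_le[of x K euclidean_metric y "mdist (CK K) x y"] assms
      by (auto simp: CK_def mdist_cfunspace_eq_mdist_funspace simp del: mdist_funspace mspace_funspace)
  qed
  then have "Lipschitz_continuous_map (CK K) euclidean_metric (\<lambda>x. x p)"
    unfolding Lipschitz_continuous_map_def by (auto intro!: exI[of _ 1])
  then show ?thesis
    using Lipschitz_continuous_imp_continuous_map by fastforce
qed

lemma orthogonally_additive_evaluations:
  assumes "p \<in> K" "q \<in> K"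
  shows "orthogonally_additive K (\<lambda>x. x p + (x q)^2)"
  using assms by (auto simp: orthogonally_additive_def fun_add_def power2_eq_square algebra_simps)

text \<open>
  The homogeneous parts come from the forms \<open>0\<close>, $x \mapsto x(p)$ and $(x, y) \mapsto x(q)\,y(q)$;
  the constant function \<open>1\<close> shows that the quadratic part is not zero.
\<close>

lemma polynomial_of_degree_evaluations:
  assumes K: "compact K" and p: "p \<in> K" and q: "q \<in> K"
  shows "polynomial_of_degree K 2 (\<lambda>x. x p + (x q)^2)"
proof -
  define Q :: "nat \<Rightarrow> ('a \<Rightarrow> complex) \<Rightarrow> complex" where
    "Q k = (if k = 0 then (\<lambda>x. 0) else if k = 1 then (\<lambda>x. x p) else (\<lambda>x. (x q)^2))" for k
  have "homogeneous_polynomial K 0 (Q 0)"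
    unfolding homogeneous_polynomial_def multilinear_form_def
    by (intro exI[of _ "\<lambda>_. 0"]) (simp add: Q_def)
  moreover have "homogeneous_polynomial K 1 (Q 1)"
    unfolding homogeneous_polynomial_def multilinear_form_def
    by (intro exI[of _ "\<lambda>xs. (xs ! 0) p"]) (use p in \<open>auto simp: Q_def fun_add_def fun_scale_def\<close>)
  moreover have "homogeneous_polynomial K 2 (Q 2)"
    unfolding homogeneous_polynomial_def multilinear_form_def
    by (intro exI[of _ "\<lambda>xs. (xs ! 0) q * (xs ! 1) q"])
      (use q in \<open>auto simp: Q_def fun_add_def fun_scale_def nth_list_update power2_eq_square
        numeral_2_eq_2 less_Suc_eq algebra_simps\<close>)
  moreover have "continuous_map (mtopology_of (CK K)) euclidean (Q k)" for k
  proof -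
    have "continuous_map (mtopology_of (CK K)) euclidean ((\<lambda>z. z^2) \<circ> (\<lambda>x. x q))"
      by (intro continuous_map_compose[OF continuous_map_evaluation[OF q]])
        (auto intro!: continuous_intros)
    then show ?thesis
      using continuous_map_evaluation[OF p] by (simp add: Q_def o_def)
  qed
  moreover have "k = 0 \<or> k = 1 \<or> k = 2" if "k \<le> 2" for k :: nat
    using that by auto
  ultimately have "continuous_homogeneous_polynomial K k (Q k)" if "k \<le> 2" for k
    using that unfolding continuous_homogeneous_polynomial_def by metis
  moreover have "(\<lambda>t\<in>K. 1) \<in> mspace (CK K)" "Q 2 (\<lambda>t\<in>K. 1) \<noteq> 0"
    using q by (auto simp: mspace_CK[OF K] Q_def cong: continuous_on_cong_simp)
  moreover have "x p + (x q)^2 = (\<Sum>k\<le>2. Q k x)" for x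
    by (simp add: Q_def eval_nat_numeral)
  ultimately show ?thesis
    unfolding polynomial_of_degree_def by blast
qed

theorem mainTheorem1:
  fixes K :: "complex set"
  defines "K \<equiv> cball 0 1"
  shows "\<not> (\<exists>\<Phi> :: complex \<Rightarrow> complex. \<Phi> holomorphic_on UNIV \<and>
    (\<forall>P :: (complex \<Rightarrow> complex) \<Rightarrow> complex.
      orthogonally_additive K P \<and> polynomial_of_degree K 2 P \<longrightarrow>
      (\<exists>\<mu>. regular_complex_borel_measure K \<mu> \<and>
        (\<forall>x\<in>mspace (CK K). P x = complex_integral (restrict_space borel K) \<mu> (\<Phi> \<circ> x)))))"
proof
  assume "\<exists>\<Phi> :: complex \<Rightarrow> complex. \<Phi> holomorphic_on UNIV \<and>
    (\<forall>P :: (complex \<Rightarrow> complex) \<Rightarrow> complex.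
      orthogonally_additive K P \<and> polynomial_of_degree K 2 P \<longrightarrow>
      (\<exists>\<mu>. regular_complex_borel_measure K \<mu> \<and>
        (\<forall>x\<in>mspace (CK K). P x = complex_integral (restrict_space borel K) \<mu> (\<Phi> \<circ> x))))"
  then obtain \<Phi> :: "complex \<Rightarrow> complex" where \<Phi>: "\<Phi> holomorphic_on UNIV"
    and rep: "\<And>P. orthogonally_additive K P \<Longrightarrow> polynomial_of_degree K 2 P \<Longrightarrow>
      \<exists>\<mu>. regular_complex_borel_measure K \<mu> \<and>
        (\<forall>x\<in>mspace (CK K). P x = complex_integral (restrict_space borel K) \<mu> (\<Phi> \<circ> x))"
    by blast
  have K: "compact K" "0 \<in> K" "1 \<in> K"
    by (simp_all add: K_def)
  define M where "M = restrict_space (borel :: complex measure) K"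
  have space_M: "space M = K"
    by (simp add: M_def space_restrict_space)
  obtain \<mu> where \<mu>: "regular_complex_borel_measure K \<mu>"
    and P: "\<And>x. x \<in> mspace (CK K) \<Longrightarrow> x 0 + (x 1)^2 = complex_integral M \<mu> (\<Phi> \<circ> x)"
    using rep[OF orthogonally_additive_evaluations[OF K(2,3)] polynomial_of_degree_evaluations[OF K]]
    unfolding M_def by blast
  have cm: "complex_measure M \<mu>"
    using \<mu> by (simp add: regular_complex_borel_measure_def Let_def M_def)
  have coeffs: "deriv \<Phi> 0 * complex_integral M \<mu> x = x 0"
      "deriv (deriv \<Phi>) 0 / 2 * complex_integral M \<mu> (\<lambda>t. (x t)^2) = (x 1)^2"
    if x: "continuous_on K x" "\<And>t. t \<in> K \<Longrightarrow> cmod (x t) \<le> 1" for x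
  proof -
    have meas: "x \<in> borel_measurable M"
      unfolding M_def using x(1) by (rule borel_measurable_continuous_on_restrict)
    have "complex_integral M \<mu> (\<lambda>t. \<Phi> (of_real s * x t))
        = x 0 * of_real s + (x 1)^2 * (of_real s)^2" for s :: real
    proof -
      have "(\<lambda>t\<in>K. of_real s * x t) \<in> mspace (CK K)"
        using x(1) by (auto simp: mspace_CK[OF K(1)] intro!: continuous_intros cong: continuous_on_cong_simp)
      from P[OF this] have "x 0 * of_real s + (x 1)^2 * (of_real s)^2
          = complex_integral M \<mu> (\<Phi> \<circ> (\<lambda>t\<in>K. of_real s * x t))"
        using K by (simp add: power_mult_distrib mult.commute)
      also have "\<dots> = complex_integral M \<mu> (\<lambda>t. \<Phi> (of_real s * x t))"
        by (intro complex_integral_cong) (simp add: space_M)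
      finally show ?thesis ..
    qed
    from complex_integral_Taylor_coefficients[OF cm \<Phi> meas _ this]
    show "deriv \<Phi> 0 * complex_integral M \<mu> x = x 0"
      "deriv (deriv \<Phi>) 0 / 2 * complex_integral M \<mu> (\<lambda>t. (x t)^2) = (x 1)^2"
      using x(2) by (simp_all add: space_M)
  qed
  have "deriv \<Phi> 0 * complex_integral M \<mu> (\<lambda>_. 1) = 1"
    by (rule coeffs(1)) auto
  then have "deriv \<Phi> 0 \<noteq> 0"
    by auto
  moreover have "deriv \<Phi> 0 * complex_integral M \<mu> (\<lambda>t. t^2) = 0^2"
    by (rule coeffs(1)) (auto simp: K_def norm_power power_le_one intro!: continuous_intros)
  ultimately have "complex_integral M \<mu> (\<lambda>t. t^2) = 0"
    by simp
  moreover have "deriv (deriv \<Phi>) 0 / 2 * complex_integral M \<mu> (\<lambda>t. t^2) = 1^2"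
    by (rule coeffs(2)) (auto simp: K_def)
  ultimately show False
    by simp
qed

end
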